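(* The absolute curvature $\kappa$ and the signed torsion $\tau$ of a stationary curve of $\mathbf{P_{curve}}$ are given by $$\kappa=\frac{\sqrt{\lambda_4^2+\lambda_5^2}}{\lambda_3}=\frac{\sqrt{1-\lambda_3^2}}{\lambda_3},\qquad\tau=\frac{W}{\lambda_4^2+\lambda_5^2},$$ with momentum components $\lambda_1(s)=\lambda_1(0)\cosh s-\lambda_5(0)\sinh s$, $\lambda_5(s)=\lambda_5(0)\cosh s-\lambda_1(0)\sinh s$, $\lambda_2(s)=\lambda_2(0)\cosh s+\lambda_4(0)\sinh s$, $\lambda_4(s)=\lambda_4(0)\cosh s+\lambda_2(0)\sinh s$, $\lambda_3(s)=\sqrt{1-\lambda_4(s)^2-\lambda_5(s)^2}$. We have the following fundamental relation between curvature and torsion: $$\tau(s)\,\kappa^2(s)=W\,(t'(s))^2.$$ The torsion is bounded as follows: $$|W|\le|\tau(s)|\le\frac{2|W|}{\sqrt{(1-\mathfrak c^2)^2+4W^2}+1-\mathfrak c^2}\qquad\text{for all }0\le s\le L\le s_{max}.$$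
   Context: Throughout $\xi=1$. Problem $\mathbf{P_{curve}}$: minimize $\int_0^L\sqrt{1+\kappa^2(s)}\,ds$ ($L$ free) among arclength-parametrized curves $\mathbf x$ in $\mathbb R^3$ with $\mathbf x(0)=\mathbf 0$, $\mathbf x'(0)=\mathbf e_z$ and prescribed $\mathbf x(L),\mathbf x'(L)$. Its stationary curves are the spatial projections $\mathbf x$ of cuspless sub-Riemannian geodesics $\gamma=(\mathbf x,R)$ in $SE(3)=\mathbb R^3\rtimes SO(3)$ with sixth momentum component $\lambda_6=0$: the initial momentum $(\lambda_1(0),\dots,\lambda_5(0))$ is normalized by $\lambda_3^2+\lambda_4^2+\lambda_5^2=1$, $\lambda_3(0)\ge0$, with $(\lambda_1,\lambda_2,\lambda_3)(0)\neq\mathbf 0$; $s_{max}\in(0,\infty]$ is the minimal $s>0$ with $\lambda_3(s)=0$ (first cusp); and for $0<s<s_{max}$, $$\mathbf x'(s)=R(s)\mathbf e_z,\qquad R'(s)=\frac1{\lambda_3(s)}R(s)\begin{pmatrix}0&0&\lambda_5(s)\\0&0&-\lambda_4(s)\\-\lambda_5(s)&\lambda_4(s)&0\end{pmatrix},\qquad\gamma(0)=(\mathbf 0,I).$$ $t(s)=\int_0^s\sqrt{1+\kappa^2(\sigma)}\,d\sigma$ is sub-Riemannian arclength. First integrals: $W=-\lambda_1\lambda_4-\lambda_2\lambda_5$, $\mathfrak c=\sqrt{\lambda_1^2+\lambda_2^2+\lambda_3^2}$. Curvature is $\kappa=\|\mathbf x''\|$ and torsion is that of the Frenet–Serret frame,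 $\tau=\frac{(\mathbf x'\times\mathbf x'')\cdot\mathbf x'''}{\|\mathbf x'\times\mathbf x''\|^2}$. The formulas are understood wherever their denominators are nonzero. *)

theory Defs
  imports "HOL-Analysis.Analysis"
begin

subsection \<open>Curvature and torsion of curves on an interval\<close>

text \<open>All derivatives are taken within the parameter interval \<open>S\<close>, hence are one-sided at its
  end points.\<close>

definition deriv_within :: "real set \<Rightarrow> (real \<Rightarrow> 'a::real_normed_vector) \<Rightarrow> real \<Rightarrow> 'a" where
  "deriv_within S f = (\<lambda>s. vector_derivative f (at s within S))"

definition curvature :: "real set \<Rightarrow> (real \<Rightarrow> real^3) \<Rightarrow> real \<Rightarrow> real" where
  "curvature S x s = norm ((deriv_within S ^^ 2) x s)"

definition frenet_torsion :: "real set \<Rightarrow> (real \<Rightarrow> real^3) \<Rightarrow> real \<Rightarrow> real" where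
  "frenet_torsion S x s =
     (let x1 = deriv_within S x s;
          x2 = (deriv_within S ^^ 2) x s;
          x3 = (deriv_within S ^^ 3) x s
      in (cross3 x1 x2 \<bullet> x3) / (norm (cross3 x1 x2))\<^sup>2)"

text \<open>At a cusp the curvature is infinite and the Frenet formula makes no sense; there the torsion
  is the limit of the torsion along the curve. \<open>Z\<close> is the set of cusp parameters.\<close>

definition torsion :: "real set \<Rightarrow> real set \<Rightarrow> (real \<Rightarrow> real^3) \<Rightarrow> real \<Rightarrow> real" where
  "torsion S Z x s =
     (if s \<in> Z then Lim (at s within S) (frenet_torsion S x) else frenet_torsion S x s)"

definition sr_arclength :: "real set \<Rightarrow> (real \<Rightarrow> real^3) \<Rightarrow> real \<Rightarrow> real" where
  "sr_arclength S x s = integral {0..s} (\<lambda>\<sigma>. sqrt (1 + (curvature S x \<sigma>)\<^sup>2))"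

subsection \<open>Cuspless sub-Riemannian geodesics in SE(3)\<close>

text \<open>A momentum is a vector in \<open>real^6\<close> whose \<open>i\<close>-th component \<open>p $ i\<close> is the momentum component
  \<open>\<lambda>\<^sub>i\<close>, dual to the left-invariant frame: 1 to 3 are the translations along the axes
  and 4 to 6 the rotations about them.\<close>

definition W_integral :: "real^6 \<Rightarrow> real" where
  "W_integral p = - p$1 * p$4 - p$2 * p$5"

definition c_integral :: "real^6 \<Rightarrow> real" where
  "c_integral p = sqrt ((p$1)\<^sup>2 + (p$2)\<^sup>2 + (p$3)\<^sup>2)"

definition admissible_initial_momentum :: "real^6 \<Rightarrow> bool" where
  "admissible_initial_momentum p \<longleftrightarrow>
     (p$3)\<^sup>2 + (p$4)\<^sup>2 + (p$5)\<^sup>2 = 1 \<and> p$3 \<ge> 0 \<and>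
     \<not> (p$1 = 0 \<and> p$2 = 0 \<and> p$3 = 0) \<and> p$6 = 0"

text \<open>\<open>smax\<close> is the least positive zero of \<open>\<lambda>\<^sub>3\<close>, or infinity if there is none. Requiring
  positivity, and not only nonvanishing, before \<open>smax\<close> matters when \<open>\<lambda>\<^sub>3\<close> vanishes at 0: it
  excludes the branch on which \<open>\<lambda>\<^sub>3\<close> is negative.\<close>

definition first_cusp :: "(real \<Rightarrow> real^6) \<Rightarrow> ereal \<Rightarrow> bool" where
  "first_cusp p smax \<longleftrightarrow>
     0 < smax \<and>
     (\<forall>s. 0 < s \<and> ereal s < smax \<longrightarrow> p s $ 3 > 0) \<and>
     (\<forall>s. smax = ereal s \<longrightarrow> p s $ 3 = 0)"

text \<open>The vertical part of the Hamiltonian system of \<open>H = (\<lambda>\<^sub>3\<^sup>2 + \<lambda>\<^sub>4\<^sup>2 + \<lambda>\<^sub>5\<^sup>2) / 2\<close> on the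
  dual of se(3). With linear momentum \<open>P = (\<lambda>\<^sub>1, \<lambda>\<^sub>2, \<lambda>\<^sub>3)\<close>, angular momentum
  \<open>M = (\<lambda>\<^sub>4, \<lambda>\<^sub>5, \<lambda>\<^sub>6)\<close>, \<open>v = (0, 0, \<lambda>\<^sub>3)\<close> and \<open>w = (\<lambda>\<^sub>4, \<lambda>\<^sub>5, 0)\<close>, the Lie-Poisson equations in
  sub-Riemannian arclength are \<open>dP/dt = P \<times> w\<close> and \<open>dM/dt = M \<times> w + P \<times> v\<close>. The factor
  \<open>1 / \<lambda>\<^sub>3 = dt/ds\<close> passes to the spatial arclength \<open>s\<close>.\<close>

definition momentum_ode_at :: "(real \<Rightarrow> real^6) \<Rightarrow> real \<Rightarrow> bool" where
  "momentum_ode_at p s \<longleftrightarrow>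
     ((\<lambda>\<sigma>. p \<sigma> $ 1) has_real_derivative (1 / p s $ 3) * (- p s $ 3 * p s $ 5)) (at s) \<and>
     ((\<lambda>\<sigma>. p \<sigma> $ 2) has_real_derivative (1 / p s $ 3) * (p s $ 3 * p s $ 4)) (at s) \<and>
     ((\<lambda>\<sigma>. p \<sigma> $ 3) has_real_derivative
        (1 / p s $ 3) * (p s $ 1 * p s $ 5 - p s $ 2 * p s $ 4)) (at s) \<and>
     ((\<lambda>\<sigma>. p \<sigma> $ 4) has_real_derivative
        (1 / p s $ 3) * (p s $ 2 * p s $ 3 - p s $ 5 * p s $ 6)) (at s) \<and>
     ((\<lambda>\<sigma>. p \<sigma> $ 5) has_real_derivative
        (1 / p s $ 3) * (p s $ 4 * p s $ 6 - p s $ 1 * p s $ 3)) (at s) \<and>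
     ((\<lambda>\<sigma>. p \<sigma> $ 6) has_real_derivative 0) (at s)"

definition e_z :: "real^3" where
  "e_z = axis 3 1"

definition rotation_generator :: "real^6 \<Rightarrow> real^3^3" where
  "rotation_generator p =
     vector [vector [0, 0, p$5],
             vector [0, 0, - p$4],
             vector [- p$5, p$4, 0]]"

definition horizontal_ode_at ::
  "(real \<Rightarrow> real^3) \<Rightarrow> (real \<Rightarrow> real^3^3) \<Rightarrow> (real \<Rightarrow> real^6) \<Rightarrow> real \<Rightarrow> bool" where
  "horizontal_ode_at x R p s \<longleftrightarrow>
     (x has_vector_derivative R s *v e_z) (at s) \<and>
     (R has_vector_derivative (1 / p s $ 3) *\<^sub>R (R s ** rotation_generator (p s))) (at s)"

text \<open>The extremal is considered up to its first cusp \<open>smax\<close>. Since \<open>\<lambda>\<^sub>3\<close> may vanish at both ends,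
  the equations are imposed on the open interval only, together with continuity up to the ends.\<close>

definition cuspless_geodesic ::
  "(real \<Rightarrow> real^3) \<Rightarrow> (real \<Rightarrow> real^3^3) \<Rightarrow> (real \<Rightarrow> real^6) \<Rightarrow> ereal \<Rightarrow> bool" where
  "cuspless_geodesic x R p smax \<longleftrightarrow>
     admissible_initial_momentum (p 0) \<and>
     first_cusp p smax \<and>
     x 0 = 0 \<and> R 0 = mat 1 \<and>
     (\<forall>s. 0 \<le> s \<and> ereal s \<le> smax \<longrightarrow> rotation_matrix (R s)) \<and>
     continuous_on {s. 0 \<le> s \<and> ereal s \<le> smax} x \<and>
     continuous_on {s. 0 \<le> s \<and> ereal s \<le> smax} R \<and>
     continuous_on {s. 0 \<le> s \<and> ereal s \<le> smax} p \<and>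
     (\<forall>s. 0 < s \<and> ereal s < smax \<longrightarrow> horizontal_ode_at x R p s \<and> momentum_ode_at p s)"

definition stationary_curve ::
  "(real \<Rightarrow> real^3) \<Rightarrow> real \<Rightarrow> (real \<Rightarrow> real^6) \<Rightarrow> ereal \<Rightarrow> bool" where
  "stationary_curve x L p smax \<longleftrightarrow>
     0 < L \<and> ereal L \<le> smax \<and> (\<exists>R. cuspless_geodesic x R p smax)"

end

theory Submission
  imports Defs
begin

text \<open>In spatial arclength the pairs \<open>(\<lambda>\<^sub>1, \<lambda>\<^sub>5)\<close> and \<open>(\<lambda>\<^sub>2, - \<lambda>\<^sub>4)\<close> both solve \<open>u' = - v\<close>, \<open>v' = - u\<close>,
  and the Hamiltonian, \<open>W\<close> and \<open>c\<close> are conserved. In the moving frame, \<open>x' = R e\<^sub>z\<close>, \<open>x'' = R u\<close>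
  with \<open>u = (\<lambda>\<^sub>5, - \<lambda>\<^sub>4, 0) / \<lambda>\<^sub>3\<close>, and \<open>x''' = R (u' + A u / \<lambda>\<^sub>3)\<close> with \<open>A\<close> the rotation generator;
  since \<open>R\<close> preserves inner and cross products, curvature and torsion are read off in the frame.
  The arclength \<open>t\<close> has density \<open>1 / \<lambda>\<^sub>3\<close>, which is singular at an initial cusp; it stays
  integrable there because \<open>\<lambda>\<^sub>3\<^sup>2 = 1 - \<lambda>\<^sub>4\<^sup>2 - \<lambda>\<^sub>5\<^sup>2\<close> is a concave function of \<open>s\<close>.\<close>

subsection \<open>Calculus on closed intervals\<close>

text \<open>The equations hold on the open interval only, while curvature and torsion take one-sided
  derivatives at its ends. Subtracting the linear part \<open>y *\<^sub>R f' s\<close> leaves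
  \<open>g\<close> with derivative \<open>f' y - f' s\<close>, which is small near \<open>s\<close>;
  the mean value inequality does the rest.\<close>

lemma has_vector_derivative_within_extend:
  fixes f :: "real \<Rightarrow> 'a::real_inner"
  assumes s: "s \<in> {a..b}"
    and cont: "continuous_on {a..b} f"
    and deriv: "\<And>y. y \<in> {a<..<b} \<Longrightarrow> (f has_vector_derivative f' y) (at y)"
    and cont': "continuous (at s within {a..b}) f'"
  shows "(f has_vector_derivative f' s) (at s within {a..b})"
  unfolding has_vector_derivative_def has_derivative_within_alt
proof (intro conjI allI impI)
  show "bounded_linear (\<lambda>h. h *\<^sub>R f' s)"
    by (rule bounded_linear_scaleR_left)
next
  fix e :: real
  assume "e > 0"
  then obtain d where d: "d > 0"
    and less: "\<And>y. y \<in> {a..b} \<Longrightarrow> dist y s < d \<Longrightarrow> dist (f' y) (f' s) < e"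
    using cont' unfolding continuous_within_eps_delta by metis
  define g where "g = (\<lambda>y. f y - y *\<^sub>R f' s)"
  have bound: "norm (g v - g u) \<le> e * (v - u)"
    if uv: "u < v" "{u..v} \<subseteq> {a..b}" and near: "\<And>y. y \<in> {u..v} \<Longrightarrow> dist y s < d" for u v
  proof -
    have contg: "continuous_on {u..v} g"
      unfolding g_def by (intro continuous_intros continuous_on_subset[OF cont uv(2)])
    have "(g has_derivative (\<lambda>h. h *\<^sub>R (f' y - f' s))) (at y)" if "u < y" "y < v" for y
    proof -
      have "y \<in> {a<..<b}" using that uv by auto
      then have "(g has_vector_derivative (f' y - f' s)) (at y)"
        unfolding g_def by (auto intro!: derivative_eq_intros deriv)
      then show ?thesis by (simp add: has_vector_derivative_def)
    qed
    from mvt_general[OF uv(1) contg this] obtain y where y: "y \<in> {u<..<v}"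
      and le: "norm (g v - g u) \<le> norm ((v - u) *\<^sub>R (f' y - f' s))" by auto
    have "norm (f' y - f' s) < e"
      using less[of y] near[of y] y uv(2) by (auto simp: dist_norm)
    then have "(v - u) * norm (f' y - f' s) \<le> (v - u) * e"
      using uv(1) by (intro mult_left_mono) auto
    moreover have "norm (g v - g u) \<le> (v - u) * norm (f' y - f' s)"
      using le uv(1) by simp
    ultimately show ?thesis by (simp only: mult.commute[of e])
  qed
  have "norm (f y - f s - (y - s) *\<^sub>R f' s) \<le> e * norm (y - s)"
    if y: "y \<in> {a..b}" "norm (y - s) < d" for y
  proof -
    have eq: "f y - f s - (y - s) *\<^sub>R f' s = g y - g s"
      by (simp add: g_def algebra_simps)
    consider "s < y" | "y = s" | "y < s" by linarith
    then show ?thesis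
    proof cases
      case 1
      then show ?thesis
        unfolding eq using bound[of s y] s y by (auto simp: dist_real_def)
    next
      case 2
      then show ?thesis by simp
    next
      case 3
      then show ?thesis
        unfolding eq using bound[of y s] s y by (auto simp: dist_real_def norm_minus_commute)
    qed
  qed
  with d show "\<exists>d>0. \<forall>y\<in>{a..b}. norm (y - s) < d \<longrightarrow>
      norm (f y - f s - (y - s) *\<^sub>R f' s) \<le> e * norm (y - s)"
    by blast
qed

lemma deriv_within_eqI:
  fixes f :: "real \<Rightarrow> 'a::real_normed_vector"
  assumes "a < b" "s \<in> {a..b}" "(f has_vector_derivative f') (at s within {a..b})"
  shows "deriv_within {a..b} f s = f'"
  unfolding deriv_within_def
  by (rule vector_derivative_within_cbox[unfolded cbox_interval]) (use assms in auto)

text \<open>The frame formula for \<open>x''\<close> is available only off the cusps, so it agrees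
  with the iterated derivative near \<open>s\<close>, not on the whole interval.\<close>

lemma has_vector_derivative_transform_eventually_within:
  assumes "(f has_vector_derivative f') (at s within S)" "s \<in> S"
    and "\<forall>\<^sub>F y in at s within S. g y = f y" "g s = f s"
  shows "(g has_vector_derivative f') (at s within S)"
proof -
  obtain d where "d > 0" "\<And>y. y \<in> S \<Longrightarrow> dist y s < d \<Longrightarrow> f y = g y"
    using assms(3,4) unfolding eventually_at by metis
  then show ?thesis
    using has_vector_derivative_transform_within[OF assms(1) _ assms(2)] by metis
qed

text \<open>A nonnegative concave function vanishes at most linearly at 0, so the singularity of
  \<open>1 / sqrt f\<close> there is no worse than that of \<open>s powr (-1/2)\<close>.\<close>

lemma integrable_inverse_sqrt_concave:
  fixes f :: "real \<Rightarrow> real"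
  assumes conc: "concave_on {0..b} f" and cont: "continuous_on {0..b} f"
    and pos: "\<And>s. s \<in> {0<..b} \<Longrightarrow> f s > 0" and f0: "f 0 \<ge> 0" and b: "b > 0"
  shows "(\<lambda>s. 1 / sqrt (f s)) integrable_on {0<..b}"
proof (rule measurable_bounded_by_integrable_imp_integrable)
  have "continuous_on {0<..b} (\<lambda>s. 1 / sqrt (f s))"
    by (intro continuous_intros continuous_on_subset[OF cont])
       (use pos in \<open>force simp: less_imp_neq\<close>)+
  then show "(\<lambda>s. 1 / sqrt (f s)) \<in> borel_measurable (lebesgue_on {0<..b})"
    by (rule continuous_imp_measurable_on_sets_lebesgue) simp
  show "(\<lambda>s. sqrt (b / f b) * s powr (-1/2)) integrable_on {0<..b}"
    by (intro integrable_on_mult_right integrable_on_powr_from_0') (use b in auto)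
  fix s
  assume s: "s \<in> {0<..b}"
  have fb: "f b > 0" using pos b by simp
  \<comment> \<open>Concavity compares \<open>f s\<close> with the chord from 0 to \<open>b\<close>;
    dropping the nonnegative share of \<open>f 0\<close> leaves the linear lower bound
    \<open>s * f b / b\<close>.\<close>
  have "f ((1 - s / b) *\<^sub>R 0 + (s / b) *\<^sub>R b) \<ge> (1 - s / b) * f 0 + (s / b) * f b"
    using s b by (intro concave_onD[OF conc]) auto
  moreover have "(1 - s / b) * f 0 \<ge> 0"
    using s b f0 by auto
  ultimately have le: "s * f b / b \<le> f s"
    using b by simp
  have "1 / sqrt (f s) \<le> 1 / sqrt (s * f b / b)"
    using le s b fb pos[OF s] by (intro divide_left_mono) auto
  also have "\<dots> = sqrt (b / f b) * s powr (-1/2)"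
    using s b fb by (simp add: powr_minus powr_half_sqrt real_sqrt_divide real_sqrt_mult field_simps)
  finally show "norm (1 / sqrt (f s)) \<le> sqrt (b / f b) * s powr (-1/2)"
    using pos[OF s] by simp
qed simp

subsection \<open>Hyperbolic rotations\<close>

text \<open>A hyperbolic rotation by \<open>s\<close> turns \<open>(u, v)\<close> into a pair
  \<open>(g, h)\<close> with zero derivative; \<open>cosh\<^sup>2 - sinh\<^sup>2 = 1\<close> inverts
  the rotation.\<close>

lemma hyperbolic_system_solution:
  fixes u v :: "real \<Rightarrow> real"
  assumes "continuous_on {0..L} u" "continuous_on {0..L} v"
    and u: "\<And>s. s \<in> {0<..<L} \<Longrightarrow> (u has_real_derivative - v s) (at s)"
    and v: "\<And>s. s \<in> {0<..<L} \<Longrightarrow> (v has_real_derivative - u s) (at s)"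
    and L: "L > 0" and s: "s \<in> {0..L}"
  shows "u s = u 0 * cosh s - v 0 * sinh s" "v s = v 0 * cosh s - u 0 * sinh s"
proof -
  define g where "g = (\<lambda>s. u s * cosh s + v s * sinh s)"
  define h where "h = (\<lambda>s. v s * cosh s + u s * sinh s)"
  have g: "g s = g 0"
  proof (rule DERIV_isconst2[of 0 L])
    show "continuous_on {0..L} g"
      unfolding g_def by (intro continuous_intros assms)
    show "(g has_real_derivative 0) (at y)" if "0 < y" "y < L" for y
      unfolding g_def using that by (auto intro!: derivative_eq_intros u v)
  qed (use L s in auto)
  have h: "h s = h 0"
  proof (rule DERIV_isconst2[of 0 L])
    show "continuous_on {0..L} h"
      unfolding h_def by (intro continuous_intros assms)
    show "(h has_real_derivative 0) (at y)" if "0 < y" "y < L" for y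
      unfolding h_def using that by (auto intro!: derivative_eq_intros u v)
  qed (use L s in auto)
  have cs: "(cosh s)\<^sup>2 - (sinh s)\<^sup>2 = (1::real)"
    by (simp add: cosh_square_eq)
  have "u 0 * cosh s - v 0 * sinh s = g s * cosh s - h s * sinh s"
    using g h by (simp add: g_def h_def)
  also have "\<dots> = u s * ((cosh s)\<^sup>2 - (sinh s)\<^sup>2)"
    by (simp add: g_def h_def power2_eq_square algebra_simps)
  finally show "u s = u 0 * cosh s - v 0 * sinh s" by (simp add: cs)
  have "v 0 * cosh s - u 0 * sinh s = h s * cosh s - g s * sinh s"
    using g h by (simp add: g_def h_def)
  also have "\<dots> = v s * ((cosh s)\<^sup>2 - (sinh s)\<^sup>2)"
    by (simp add: g_def h_def power2_eq_square algebra_simps)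
  finally show "v s = v 0 * cosh s - u 0 * sinh s" by (simp add: cs)
qed

text \<open>A combination \<open>f\<close> of cosh and sinh satisfies \<open>f'' = f\<close>, so
  \<open>(f\<^sup>2)'' = 2 f'\<^sup>2 + 2 f\<^sup>2\<close> is nonnegative.\<close>

lemma convex_on_square_hyperbolic:
  "convex_on UNIV (\<lambda>s::real. (a * cosh s + b * sinh s)\<^sup>2)"
proof (rule f''_ge0_imp_convex)
  show "((\<lambda>s. (a * cosh s + b * sinh s)\<^sup>2) has_real_derivative
      2 * (a * cosh s + b * sinh s) * (a * sinh s + b * cosh s)) (at s)" for s
    by (auto intro!: derivative_eq_intros simp: algebra_simps)
  show "((\<lambda>s. 2 * (a * cosh s + b * sinh s) * (a * sinh s + b * cosh s)) has_real_derivative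
      2 * (a * sinh s + b * cosh s)\<^sup>2 + 2 * (a * cosh s + b * sinh s)\<^sup>2) (at s)" for s
    by (auto intro!: derivative_eq_intros simp: power2_eq_square algebra_simps)
qed auto

subsection \<open>Matrices\<close>

lemma bounded_bilinear_matrix_vector_mult:
  "bounded_bilinear ((*v) :: real^'n^'m \<Rightarrow> real^'n \<Rightarrow> real^'m)"
  by (simp add: bilinear_conv_bounded_bilinear[symmetric] bilinear_def linear_iff
      matrix_vector_mult_add_rdistrib matrix_vector_right_distrib
      scaleR_matrix_vector_assoc[symmetric] matrix_vector_mult_scaleR)

lemma bounded_bilinear_matrix_matrix_mult:
  "bounded_bilinear ((**) :: real^'n^'m \<Rightarrow> real^'k^'n \<Rightarrow> real^'k^'m)"
  by (simp add: bilinear_conv_bounded_bilinear[symmetric] bilinear_def linear_iff vec_eq_iff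
      matrix_matrix_mult_def sum.distrib sum_distrib_left algebra_simps)

lemma rotation_generator_mult:
  "(rotation_generator q *v v) $ 1 = q $ 5 * v $ 3"
  "(rotation_generator q *v v) $ 2 = - q $ 4 * v $ 3"
  "(rotation_generator q *v v) $ 3 = q $ 4 * v $ 2 - q $ 5 * v $ 1"
  by (simp_all add: rotation_generator_def matrix_vector_mult_def sum_3)

lemma bounded_linear_rotation_generator: "bounded_linear rotation_generator"
  by (simp add: linear_conv_bounded_linear[symmetric] linear_iff rotation_generator_def
      vec_eq_iff forall_3)

lemma rotation_matrix_inner:
  assumes "rotation_matrix (A :: real^'n^'n)"
  shows "(A *v u) \<bullet> (A *v v) = u \<bullet> v"
  using assms orthogonal_transformation_matrix[of "(*v) A"]
  by (simp add: rotation_matrix_def orthogonal_transformation_def)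

lemma rotation_matrix_norm:
  assumes "rotation_matrix (A :: real^'n^'n)"
  shows "norm (A *v u) = norm u"
  by (simp add: norm_eq_sqrt_inner rotation_matrix_inner[OF assms])

subsection \<open>Momentum along a cuspless geodesic\<close>

text \<open>\<open>L = smax\<close> is allowed, so cusps can occur at both ends of
  \<open>{0..L}\<close>, but not inside.\<close>

locale cuspless_arc =
  fixes x :: "real \<Rightarrow> real^3" and R :: "real \<Rightarrow> real^3^3" and p :: "real \<Rightarrow> real^6"
    and L :: real and smax :: ereal
  assumes geodesic: "cuspless_geodesic x R p smax"
    and L_pos: "0 < L" and L_le: "ereal L \<le> smax"
begin

lemma before_smax: "s < L \<Longrightarrow> ereal s < smax" "s \<le> L \<Longrightarrow> ereal s \<le> smax"
  using L_le by (meson ereal_less_eq(3) less_ereal.simps(1) less_le_trans order_trans)+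

lemma subset_domain: "{0..L} \<subseteq> {s. 0 \<le> s \<and> ereal s \<le> smax}"
  using before_smax by auto

lemma continuous_on_x: "continuous_on {0..L} x"
  and continuous_on_R: "continuous_on {0..L} R"
  and continuous_on_p: "continuous_on {0..L} p"
  using geodesic continuous_on_subset[OF _ subset_domain]
  unfolding cuspless_geodesic_def by blast+

lemma continuous_on_momentum [continuous_intros]: "continuous_on {0..L} (\<lambda>s. p s $ i)"
  by (intro continuous_intros continuous_on_p)

lemma rotation_R: "s \<in> {0..L} \<Longrightarrow> rotation_matrix (R s)"
  using geodesic before_smax unfolding cuspless_geodesic_def by auto

lemma lambda3_pos: "s \<in> {0<..<L} \<Longrightarrow> p s $ 3 > 0"
  using geodesic before_smax unfolding cuspless_geodesic_def first_cusp_def by auto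

lemma lambda3_nonneg:
  assumes "s \<in> {0..L}"
  shows "p s $ 3 \<ge> 0"
proof -
  consider "s = 0" | "s \<in> {0<..<L}" | "s = L" using assms by fastforce
  then show ?thesis
  proof cases
    case 1
    then show ?thesis
      using geodesic unfolding cuspless_geodesic_def admissible_initial_momentum_def by auto
  next
    case 2
    then show ?thesis using lambda3_pos by (auto intro: less_imp_le)
  next
    case 3
    then show ?thesis
      using L_pos L_le geodesic
      unfolding cuspless_geodesic_def first_cusp_def by (cases "ereal L < smax") auto
  qed
qed

lemma momentum_ode: "s \<in> {0<..<L} \<Longrightarrow> momentum_ode_at p s"
  and horizontal_ode: "s \<in> {0<..<L} \<Longrightarrow> horizontal_ode_at x R p s"
  using geodesic before_smax unfolding cuspless_geodesic_def by auto

text \<open>Once the \<open>\<lambda>\<^sub>6\<close> terms are gone, the equations for components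
  1, 2, 4, 5 are linear and split into two pairs.\<close>

lemma lambda6_eq_0:
  assumes "s \<in> {0..L}"
  shows "p s $ 6 = 0"
proof -
  have "p s $ 6 = p 0 $ 6"
    by (rule DERIV_isconst2[OF L_pos continuous_on_momentum])
       (use momentum_ode assms in \<open>auto simp: momentum_ode_at_def\<close>)
  also have "\<dots> = 0"
    using geodesic unfolding cuspless_geodesic_def admissible_initial_momentum_def by auto
  finally show ?thesis .
qed

lemma momentum_derivs_interior:
  assumes s: "s \<in> {0<..<L}"
  shows "((\<lambda>s. p s $ 1) has_real_derivative - p s $ 5) (at s)"
    and "((\<lambda>s. p s $ 2) has_real_derivative p s $ 4) (at s)"
    and "((\<lambda>s. p s $ 3) has_real_derivative (p s $ 1 * p s $ 5 - p s $ 2 * p s $ 4) / p s $ 3) (at s)"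
    and "((\<lambda>s. p s $ 4) has_real_derivative p s $ 2) (at s)"
    and "((\<lambda>s. p s $ 5) has_real_derivative - p s $ 1) (at s)"
  using momentum_ode[OF s] lambda3_pos[OF s] lambda6_eq_0[of s] s
  by (simp_all add: momentum_ode_at_def)

lemma momentum_explicit:
  assumes s: "s \<in> {0..L}"
  shows "p s $ 1 = p 0 $ 1 * cosh s - p 0 $ 5 * sinh s"
    and "p s $ 5 = p 0 $ 5 * cosh s - p 0 $ 1 * sinh s"
    and "p s $ 2 = p 0 $ 2 * cosh s + p 0 $ 4 * sinh s"
    and "p s $ 4 = p 0 $ 4 * cosh s + p 0 $ 2 * sinh s"
proof -
  show "p s $ 1 = p 0 $ 1 * cosh s - p 0 $ 5 * sinh s"
    and "p s $ 5 = p 0 $ 5 * cosh s - p 0 $ 1 * sinh s"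
    using hyperbolic_system_solution[of L "\<lambda>s. p s $ 1" "\<lambda>s. p s $ 5",
        OF continuous_on_momentum continuous_on_momentum
          momentum_derivs_interior(1,5) L_pos s] by auto
  have deriv: "((\<lambda>s. - p s $ 4) has_real_derivative - p y $ 2) (at y)" if "y \<in> {0<..<L}" for y
    by (intro DERIV_minus momentum_derivs_interior that)
  \<comment> \<open>The double negation gives the fact the shape \<open>u' = - v\<close> with
    \<open>v = - \<lambda>\<^sub>4\<close>.\<close>
  have "((\<lambda>s. p s $ 2) has_real_derivative - (- p y $ 4)) (at y)" if "y \<in> {0<..<L}" for y
    using momentum_derivs_interior(2)[OF that] by simp
  note sol = hyperbolic_system_solution[of L "\<lambda>s. p s $ 2" "\<lambda>s. - p s $ 4", OF _ _ this deriv L_pos s]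
  have "continuous_on {0..L} (\<lambda>s. - p s $ 4)" by (intro continuous_intros)
  from sol[OF continuous_on_momentum this]
  show "p s $ 2 = p 0 $ 2 * cosh s + p 0 $ 4 * sinh s"
    and "p s $ 4 = p 0 $ 4 * cosh s + p 0 $ 2 * sinh s" by auto
qed

text \<open>In the derivative of the squares the factor \<open>\<lambda>\<^sub>3\<close> cancels
  against the denominator of \<open>\<lambda>\<^sub>3'\<close>. This needs an interior point;
  continuity carries the identity to the ends.\<close>

lemma hamiltonian_eq:
  assumes s: "s \<in> {0..L}"
  shows "(p s $ 3)\<^sup>2 + (p s $ 4)\<^sup>2 + (p s $ 5)\<^sup>2 = 1"
proof -
  define h where "h = (\<lambda>s. (p s $ 3)\<^sup>2 + (p s $ 4)\<^sup>2 + (p s $ 5)\<^sup>2)"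
  have "h s = h 0"
  proof (rule DERIV_isconst2[OF L_pos])
    show "continuous_on {0..L} h"
      unfolding h_def by (intro continuous_intros)
    show "(h has_real_derivative 0) (at y)" if "0 < y" "y < L" for y
    proof -
      have y: "y \<in> {0<..<L}" using that by simp
      note d = momentum_derivs_interior[OF y]
      have "(h has_real_derivative 2 * p y $ 3 * ((p y $ 1 * p y $ 5 - p y $ 2 * p y $ 4) / p y $ 3)
          + 2 * p y $ 4 * p y $ 2 + 2 * p y $ 5 * (- p y $ 1)) (at y)"
        unfolding h_def by (auto intro!: derivative_eq_intros d)
      also have "2 * p y $ 3 * ((p y $ 1 * p y $ 5 - p y $ 2 * p y $ 4) / p y $ 3)
          + 2 * p y $ 4 * p y $ 2 + 2 * p y $ 5 * (- p y $ 1) = 0"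
        using lambda3_pos[OF y] by simp
      finally show ?thesis .
    qed
  qed (use s in auto)
  also have "h 0 = 1"
    using geodesic
    unfolding h_def cuspless_geodesic_def admissible_initial_momentum_def by auto
  finally show ?thesis by (simp add: h_def)
qed

text \<open>Up to sign, \<open>W\<close> is the Casimir \<open>P . M\<close> of se(3) at
  \<open>\<lambda>\<^sub>6 = 0\<close>.\<close>

lemma W_const:
  assumes s: "s \<in> {0..L}"
  shows "W_integral (p s) = W_integral (p 0)"
proof -
  have cont: "continuous_on {0..L} (\<lambda>s. W_integral (p s))"
    unfolding W_integral_def by (intro continuous_intros)
  have "((\<lambda>s. W_integral (p s)) has_real_derivative 0) (at y)" if "0 < y" "y < L" for y
  proof -
    have y: "y \<in> {0<..<L}" using that by simp
    note d = momentum_derivs_interior[OF y]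
    show ?thesis
      unfolding W_integral_def by (auto intro!: derivative_eq_intros d simp: algebra_simps)
  qed
  then show ?thesis
    by (rule DERIV_isconst2[OF L_pos cont]) (use s in auto)
qed

text \<open>The other Casimir, \<open>P . P\<close>, stated for the square because the bounds
  involve only \<open>c\<^sup>2\<close>.\<close>

lemma c_const:
  assumes s: "s \<in> {0..L}"
  shows "(c_integral (p 0))\<^sup>2 = (p s $ 1)\<^sup>2 + (p s $ 2)\<^sup>2 + (p s $ 3)\<^sup>2"
proof -
  define h where "h = (\<lambda>s. (p s $ 1)\<^sup>2 + (p s $ 2)\<^sup>2 + (p s $ 3)\<^sup>2)"
  have "h s = h 0"
  proof (rule DERIV_isconst2[OF L_pos])
    show "continuous_on {0..L} h"
      unfolding h_def by (intro continuous_intros)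
    show "(h has_real_derivative 0) (at y)" if "0 < y" "y < L" for y
    proof -
      have y: "y \<in> {0<..<L}" using that by simp
      note d = momentum_derivs_interior[OF y]
      have "(h has_real_derivative 2 * p y $ 1 * (- p y $ 5) + 2 * p y $ 2 * p y $ 4
          + 2 * p y $ 3 * ((p y $ 1 * p y $ 5 - p y $ 2 * p y $ 4) / p y $ 3)) (at y)"
        unfolding h_def by (auto intro!: derivative_eq_intros d)
      also have "2 * p y $ 1 * (- p y $ 5) + 2 * p y $ 2 * p y $ 4
          + 2 * p y $ 3 * ((p y $ 1 * p y $ 5 - p y $ 2 * p y $ 4) / p y $ 3) = 0"
        using lambda3_pos[OF y] by simp
      finally show ?thesis .
    qed
  qed (use s in auto)
  then show ?thesis by (simp add: h_def c_integral_def)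
qed

lemma lambda3_eq: "s \<in> {0..L} \<Longrightarrow> p s $ 3 = sqrt (1 - (p s $ 4)\<^sup>2 - (p s $ 5)\<^sup>2)"
  using hamiltonian_eq[of s] lambda3_nonneg[of s]
  by (intro real_sqrt_unique[symmetric]) (auto simp: algebra_simps)

lemma continuous_momentum:
  "s \<in> {0..L} \<Longrightarrow> continuous (at s within {0..L}) (\<lambda>s. p s $ i)"
  using continuous_on_momentum by (auto simp: continuous_on_eq_continuous_within)

text \<open>At an end point that is no cusp the right-hand sides are still continuous, so the
  equations persist there with one-sided derivatives.\<close>

lemma momentum_derivs_within:
  assumes s: "s \<in> {0..L}" and nz: "p s $ 3 \<noteq> 0"
  shows "((\<lambda>s. p s $ 3) has_real_derivative (p s $ 1 * p s $ 5 - p s $ 2 * p s $ 4) / p s $ 3)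
           (at s within {0..L})"
    and "((\<lambda>s. p s $ 4) has_real_derivative p s $ 2) (at s within {0..L})"
    and "((\<lambda>s. p s $ 5) has_real_derivative - p s $ 1) (at s within {0..L})"
proof -
  note extend = has_vector_derivative_within_extend[OF s continuous_on_momentum,
      folded has_real_derivative_iff_has_vector_derivative]
  note cont = continuous_momentum[OF s]
  show "((\<lambda>s. p s $ 3) has_real_derivative (p s $ 1 * p s $ 5 - p s $ 2 * p s $ 4) / p s $ 3)
      (at s within {0..L})"
    by (rule extend[where f' = "\<lambda>s. (p s $ 1 * p s $ 5 - p s $ 2 * p s $ 4) / p s $ 3"])
       (intro momentum_derivs_interior continuous_at_within_divide continuous_diff
         continuous_mult cont nz; assumption)+
  show "((\<lambda>s. p s $ 4) has_real_derivative p s $ 2) (at s within {0..L})"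
    by (rule extend[where f' = "\<lambda>s. p s $ 2"]) (intro momentum_derivs_interior cont; assumption)+
  show "((\<lambda>s. p s $ 5) has_real_derivative - p s $ 1) (at s within {0..L})"
    by (rule extend[where f' = "\<lambda>s. - p s $ 1"])
       (intro momentum_derivs_interior continuous_minus cont; assumption)+
qed

subsection \<open>Curvature and torsion\<close>

text \<open>The equation for \<open>x\<close> has no factor \<open>1 / \<lambda>\<^sub>3\<close>, so
  unlike the one for \<open>R\<close> it extends to the cusps as well.\<close>

lemma deriv_x: "s \<in> {0..L} \<Longrightarrow> deriv_within {0..L} x s = R s *v e_z"
proof (rule deriv_within_eqI[OF L_pos])
  assume s: "s \<in> {0..L}"
  have "continuous_on {0..L} (\<lambda>s. R s *v e_z)"
    by (intro bounded_bilinear.continuous_on[OF bounded_bilinear_matrix_vector_mult]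
        continuous_on_R continuous_intros)
  then show "(x has_vector_derivative R s *v e_z) (at s within {0..L})"
    using s horizontal_ode
    by (intro has_vector_derivative_within_extend[OF s continuous_on_x,
          where f' = "\<lambda>s. R s *v e_z"])
       (auto simp: horizontal_ode_at_def continuous_on_eq_continuous_within)
qed

text \<open>The coordinates of \<open>x''\<close> in the moving frame, split along the axes so that
  they can be differentiated term by term.\<close>

definition body_curvature :: "real \<Rightarrow> real^3" where
  "body_curvature s = (p s $ 5 / p s $ 3) *\<^sub>R axis 1 1 - (p s $ 4 / p s $ 3) *\<^sub>R axis 2 1"

lemma body_curvature_nth:
  "body_curvature s $ 1 = p s $ 5 / p s $ 3"
  "body_curvature s $ 2 = - p s $ 4 / p s $ 3"
  "body_curvature s $ 3 = 0"
  by (simp_all add: body_curvature_def axis_def)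

lemma R_deriv_within:
  assumes s: "s \<in> {0..L}" and nz: "p s $ 3 \<noteq> 0"
  shows "(R has_vector_derivative (1 / p s $ 3) *\<^sub>R (R s ** rotation_generator (p s)))
           (at s within {0..L})"
proof (rule has_vector_derivative_within_extend[OF s continuous_on_R,
      where f' = "\<lambda>s. (1 / p s $ 3) *\<^sub>R (R s ** rotation_generator (p s))"])
  have R: "continuous (at s within {0..L}) R"
    using continuous_on_R s by (auto simp: continuous_on_eq_continuous_within)
  have p: "continuous (at s within {0..L}) p"
    using continuous_on_p s by (auto simp: continuous_on_eq_continuous_within)
  show "continuous (at s within {0..L}) (\<lambda>s. (1 / p s $ 3) *\<^sub>R (R s ** rotation_generator (p s)))"
    by (intro continuous_scaleR continuous_at_within_divide continuous_const
        bounded_bilinear.continuous[OF bounded_bilinear_matrix_matrix_mult]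
        bounded_linear.continuous[OF bounded_linear_rotation_generator]
        R p continuous_momentum[OF s] nz)
qed (use horizontal_ode in \<open>auto simp: horizontal_ode_at_def\<close>)

lemma second_deriv_x:
  assumes s: "s \<in> {0..L}" and nz: "p s $ 3 \<noteq> 0"
  shows "(deriv_within {0..L} ^^ 2) x s = R s *v body_curvature s"
proof -
  have "((\<lambda>s. R s *v e_z) has_vector_derivative
      ((1 / p s $ 3) *\<^sub>R (R s ** rotation_generator (p s))) *v e_z) (at s within {0..L})"
    using bounded_bilinear.has_vector_derivative[OF bounded_bilinear_matrix_vector_mult
        R_deriv_within[OF s nz] has_vector_derivative_const[of e_z]] by simp
  moreover have "((1 / p s $ 3) *\<^sub>R (R s ** rotation_generator (p s))) *v e_z
      = R s *v ((1 / p s $ 3) *\<^sub>R (rotation_generator (p s) *v e_z))"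
    by (simp add: scaleR_matrix_vector_assoc[symmetric] matrix_vector_mul_assoc
        matrix_vector_mult_scaleR)
  moreover have "(1 / p s $ 3) *\<^sub>R (rotation_generator (p s) *v e_z) = body_curvature s"
    by (simp add: vec_eq_iff forall_3 rotation_generator_mult body_curvature_nth e_z_def axis_def)
  ultimately have "((\<lambda>s. R s *v e_z) has_vector_derivative R s *v body_curvature s)
      (at s within {0..L})"
    by simp
  then have "(deriv_within {0..L} x has_vector_derivative R s *v body_curvature s)
      (at s within {0..L})"
    by (rule has_vector_derivative_transform[OF s, rotated]) (rule deriv_x)
  then show ?thesis
    by (simp add: numeral_2_eq_2 deriv_within_eqI[OF L_pos s])
qed

lemma body_curvature_norm:
  assumes s: "s \<in> {0..L}"
  shows "norm (body_curvature s) = sqrt ((p s $ 4)\<^sup>2 + (p s $ 5)\<^sup>2) / p s $ 3"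
proof -
  have "(norm (body_curvature s))\<^sup>2 = ((p s $ 4)\<^sup>2 + (p s $ 5)\<^sup>2) / (p s $ 3)\<^sup>2"
    unfolding power2_norm_eq_inner
    by (simp add: inner_vec_def sum_3 body_curvature_nth power2_eq_square add_divide_distrib)
  then have "norm (body_curvature s) = sqrt (((p s $ 4)\<^sup>2 + (p s $ 5)\<^sup>2) / (p s $ 3)\<^sup>2)"
    by (metis norm_ge_zero real_sqrt_unique)
  with lambda3_nonneg[OF s] show ?thesis by (simp add: real_sqrt_divide)
qed

lemma curvature_eq:
  assumes s: "s \<in> {0..L}" and nz: "p s $ 3 \<noteq> 0"
  shows "curvature {0..L} x s = sqrt ((p s $ 4)\<^sup>2 + (p s $ 5)\<^sup>2) / p s $ 3"
  by (simp add: curvature_def second_deriv_x[OF s nz] rotation_matrix_norm[OF rotation_R[OF s]]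
      body_curvature_norm[OF s])

lemma eventually_not_cusp:
  assumes s: "s \<in> {0..L}"
  shows "\<forall>\<^sub>F y in at s within {0..L}. y \<in> {0..L} \<and> p y $ 3 \<noteq> 0"
proof (cases "s \<in> {0<..<L}")
  case False
  then have "s = 0 \<or> s = L" using s by auto
  \<comment> \<open>A point of \<open>{0..L}\<close> that differs from the end \<open>s\<close> and
    is closer to it than \<open>L\<close> is interior, so the radius \<open>L\<close> works.\<close>
  then have "\<forall>y\<in>{0..L}. y \<noteq> s \<and> dist y s < L \<longrightarrow> y \<in> {0<..<L}"
    by (auto simp: dist_real_def)
  then have "\<forall>\<^sub>F y in at s within {0..L}. y \<in> {0<..<L}"
    unfolding eventually_at using L_pos by blast
  then show ?thesis
    by eventually_elim (use lambda3_pos in force)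
next
  case True
  then have "\<forall>\<^sub>F y in nhds s. y \<in> {0<..<L}"
    by (intro eventually_nhds_in_open) auto
  then have "\<forall>\<^sub>F y in at s within {0..L}. y \<in> {0<..<L}"
    by (auto simp: eventually_at_filter elim: eventually_mono)
  then show ?thesis
    by eventually_elim (use lambda3_pos in force)
qed

lemma frenet_torsion_eq:
  assumes s: "s \<in> {0..L}" and nz: "p s $ 3 \<noteq> 0"
  shows "frenet_torsion {0..L} x s = W_integral (p 0) / ((p s $ 4)\<^sup>2 + (p s $ 5)\<^sup>2)"
proof -
  \<comment> \<open>Here \<open>d\<close> is the derivative of \<open>\<lambda>\<^sub>3\<close>,
    \<open>a\<close> and \<open>b\<close> are those of
    \<open>\<lambda>\<^sub>5 / \<lambda>\<^sub>3\<close> and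
    \<open>\<lambda>\<^sub>4 / \<lambda>\<^sub>3\<close>, and \<open>w\<close> holds the frame
    coordinates of \<open>x'''\<close>.\<close>
  define d where "d = (p s $ 1 * p s $ 5 - p s $ 2 * p s $ 4) / p s $ 3"
  define a where "a = (- p s $ 1 * p s $ 3 - p s $ 5 * d) / (p s $ 3 * p s $ 3)"
  define b where "b = (p s $ 2 * p s $ 3 - p s $ 4 * d) / (p s $ 3 * p s $ 3)"
  define u where "u = body_curvature s"
  define w :: "real^3" where
    "w = a *\<^sub>R axis 1 1 - b *\<^sub>R axis 2 1 + (1 / p s $ 3) *\<^sub>R (rotation_generator (p s) *v u)"
  note dp = momentum_derivs_within[OF s nz, folded d_def]
  have "((\<lambda>s. p s $ 5 / p s $ 3) has_vector_derivative a) (at s within {0..L})"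
    unfolding a_def has_real_derivative_iff_has_vector_derivative[symmetric]
    using DERIV_divide[OF dp(3) dp(1) nz] .
  moreover have "((\<lambda>s. p s $ 4 / p s $ 3) has_vector_derivative b) (at s within {0..L})"
    unfolding b_def has_real_derivative_iff_has_vector_derivative[symmetric]
    using DERIV_divide[OF dp(2) dp(1) nz] .
  ultimately have "(body_curvature has_vector_derivative a *\<^sub>R axis 1 1 - b *\<^sub>R axis 2 1)
      (at s within {0..L})"
    unfolding body_curvature_def
    by (intro has_vector_derivative_diff
        bounded_linear.has_vector_derivative[OF bounded_linear_scaleR_left])
  from bounded_bilinear.has_vector_derivative[OF bounded_bilinear_matrix_vector_mult
      R_deriv_within[OF s nz] this]
  have "((\<lambda>s. R s *v body_curvature s) has_vector_derivative R s *v w) (at s within {0..L})"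
    by (simp add: w_def u_def scaleR_matrix_vector_assoc[symmetric] matrix_vector_mul_assoc
        matrix_vector_mult_scaleR matrix_vector_right_distrib)
  then have "((deriv_within {0..L} ^^ 2) x has_vector_derivative R s *v w) (at s within {0..L})"
    by (rule has_vector_derivative_transform_eventually_within)
       (use s nz in \<open>auto simp: second_deriv_x intro: eventually_mono[OF eventually_not_cusp[OF s]]\<close>)
  then have third: "(deriv_within {0..L} ^^ 3) x s = R s *v w"
    by (simp add: eval_nat_numeral deriv_within_eqI[OF L_pos s])
  have rot: "rotation_matrix (R s)" by (rule rotation_R[OF s])
  have normal: "cross3 e_z u $ 1 = p s $ 4 / p s $ 3" "cross3 e_z u $ 2 = p s $ 5 / p s $ 3"
    "cross3 e_z u $ 3 = 0"
    by (simp_all add: u_def body_curvature_nth e_z_def cross3_def axis_def)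
  have "(norm (cross3 e_z u))\<^sup>2 = ((p s $ 4)\<^sup>2 + (p s $ 5)\<^sup>2) / (p s $ 3)\<^sup>2"
    unfolding power2_norm_eq_inner
    by (simp add: inner_vec_def sum_3 normal power2_eq_square add_divide_distrib)
  \<comment> \<open>As \<open>u\<close> has no third component, the rotation term of
    \<open>w\<close> points along \<open>e_z\<close>, which is orthogonal to the cross product, and
    drops out.\<close>
  moreover have "cross3 e_z u \<bullet> w = (p s $ 4 / p s $ 3) * a - (p s $ 5 / p s $ 3) * b"
    by (simp add: inner_vec_def sum_3 normal w_def axis_def rotation_generator_mult
        body_curvature_nth(3)[folded u_def] algebra_simps)
  \<comment> \<open>The two terms containing \<open>d\<close> cancel, and what remains is
    \<open>W\<close>.\<close>
  moreover have "(p s $ 4 / p s $ 3) * a - (p s $ 5 / p s $ 3) * b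
      = W_integral (p s) / (p s $ 3)\<^sup>2"
    using nz by (simp add: a_def b_def W_integral_def field_simps power2_eq_square)
  \<comment> \<open>If \<open>\<lambda>\<^sub>4\<close> and \<open>\<lambda>\<^sub>5\<close> both
    vanish, each side is 0 by the convention for division by 0.\<close>
  ultimately have "(cross3 e_z u \<bullet> w) / (norm (cross3 e_z u))\<^sup>2
      = W_integral (p s) / ((p s $ 4)\<^sup>2 + (p s $ 5)\<^sup>2)"
    using nz by simp
  then show ?thesis
    using s nz
    by (simp add: frenet_torsion_def deriv_x second_deriv_x third cross_rotation_matrix[OF rot]
        rotation_matrix_inner[OF rot] rotation_matrix_norm[OF rot] u_def W_const[OF s])
qed

text \<open>At a cusp the Hamiltonian forces
  \<open>\<lambda>\<^sub>4\<^sup>2 + \<lambda>\<^sub>5\<^sup>2 = 1\<close>, so the denominator has a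
  nonzero limit.\<close>

lemma frenet_torsion_tendsto_cusp:
  assumes s: "s \<in> {0..L}" and cusp: "p s $ 3 = 0"
  shows "(frenet_torsion {0..L} x \<longlongrightarrow> W_integral (p 0) / ((p s $ 4)\<^sup>2 + (p s $ 5)\<^sup>2))
           (at s within {0..L})"
proof -
  have "((\<lambda>y. p y $ i) \<longlongrightarrow> p s $ i) (at s within {0..L})" for i
    using continuous_momentum[OF s] by (simp add: continuous_within)
  then have "((\<lambda>y. W_integral (p 0) / ((p y $ 4)\<^sup>2 + (p y $ 5)\<^sup>2))
      \<longlongrightarrow> W_integral (p 0) / ((p s $ 4)\<^sup>2 + (p s $ 5)\<^sup>2)) (at s within {0..L})"
    using hamiltonian_eq[OF s] cusp
    by (intro tendsto_divide tendsto_add tendsto_power tendsto_const) auto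
  moreover have "\<forall>\<^sub>F y in at s within {0..L}.
      W_integral (p 0) / ((p y $ 4)\<^sup>2 + (p y $ 5)\<^sup>2) = frenet_torsion {0..L} x y"
    using eventually_not_cusp[OF s] by eventually_elim (simp add: frenet_torsion_eq)
  ultimately show ?thesis by (rule Lim_transform_eventually)
qed

lemma torsion_eq:
  assumes s: "s \<in> {0..L}"
  shows "torsion {0..L} {s. p s $ 3 = 0} x s = W_integral (p 0) / ((p s $ 4)\<^sup>2 + (p s $ 5)\<^sup>2)"
proof (cases "p s $ 3 = 0")
  case True
  \<comment> \<open>The value of \<open>Lim\<close> is determined because \<open>s\<close> is not
    isolated in the interval.\<close>
  have "at s within {0..L} \<noteq> bot"
    using s L_pos by (simp add: trivial_limit_within islimpt_Icc)
  with True frenet_torsion_tendsto_cusp[OF s True] show ?thesis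
    by (simp add: torsion_def tendsto_Lim)
qed (use frenet_torsion_eq[OF s] in \<open>simp add: torsion_def\<close>)

subsection \<open>Sub-Riemannian arclength\<close>

lemma arclength_density:
  assumes s: "s \<in> {0..L}" and nz: "p s $ 3 \<noteq> 0"
  shows "sqrt (1 + (curvature {0..L} x s)\<^sup>2) = 1 / p s $ 3"
proof -
  have "1 + (curvature {0..L} x s)\<^sup>2 = (1 / p s $ 3)\<^sup>2"
    using hamiltonian_eq[OF s] nz
    by (simp add: curvature_eq[OF s nz] power_divide field_simps)
  with lambda3_nonneg[OF s] show ?thesis by simp
qed

text \<open>As \<open>b\<close> is no cusp, the density can be singular only at 0, where concavity
  of \<open>\<lambda>\<^sub>3\<^sup>2\<close> controls it.\<close>

lemma arclength_density_integrable:
  assumes b: "b \<in> {0<..L}" and nz: "p b $ 3 \<noteq> 0"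
  shows "(\<lambda>s. sqrt (1 + (curvature {0..L} x s)\<^sup>2)) integrable_on {0..b}"
proof -
  \<comment> \<open>This is \<open>\<lambda>\<^sub>3\<^sup>2\<close> in terms of the initial
    momentum, with each square in the form \<open>a * cosh s + b * sinh s\<close>.\<close>
  define F where "F = (\<lambda>s::real. 1 - (p 0 $ 4 * cosh s + p 0 $ 2 * sinh s)\<^sup>2
                                   - (p 0 $ 5 * cosh s + (- p 0 $ 1) * sinh s)\<^sup>2)"
  have F: "sqrt (F s) = p s $ 3" if "s \<in> {0..L}" for s
    using lambda3_eq[OF that] momentum_explicit[OF that] by (simp add: F_def)
  have pos: "p s $ 3 > 0" if "s \<in> {0<..b}" for s
  proof (cases "s = b")
    case True
    then show ?thesis using lambda3_nonneg[of b] b nz by (auto simp: less_le)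
  qed (use that b lambda3_pos[of s] in auto)
  have "concave_on UNIV F"
    unfolding F_def
    by (intro concave_on_diff convex_on_square_hyperbolic) (auto simp: concave_on_const)
  then have "concave_on {0..b} F" unfolding concave_on_def by (rule convex_on_subset) auto
  moreover have "continuous_on {0..b} F"
    unfolding F_def by (intro continuous_intros)
  moreover have "F s > 0" if "s \<in> {0<..b}" for s
  proof -
    have "sqrt (F s) > 0" using pos[OF that] F[of s] that b by simp
    then show ?thesis by simp
  qed
  moreover have "F 0 \<ge> 0"
  proof -
    have "sqrt (F 0) \<ge> 0" using F[of 0] lambda3_nonneg[of 0] L_pos by simp
    then show ?thesis by simp
  qed
  ultimately have "(\<lambda>s. 1 / sqrt (F s)) integrable_on {0<..b}"
    using b by (intro integrable_inverse_sqrt_concave) auto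
  then have "(\<lambda>s. 1 / sqrt (F s)) integrable_on {0..b}"
    by (rule integrable_spike_set) (rule negligible_subset[of "{0}"]; auto)+
  then show ?thesis
  \<comment> \<open>At 0, a possible cusp, the density need not equal
    \<open>1 / \<lambda>\<^sub>3\<close>, but a single point does not affect integrability.\<close>
  proof (rule integrable_spike_finite[of "{0}", rotated 2])
    fix s
    assume "s \<in> {0..b} - {0}"
    then show "sqrt (1 + (curvature {0..L} x s)\<^sup>2) = 1 / sqrt (F s)"
      using pos[of s] F[of s] b arclength_density[of s] by auto
  qed simp
qed

lemma sr_arclength_has_derivative:
  assumes s: "s \<in> {0..L}" and nz: "p s $ 3 \<noteq> 0"
  shows "(sr_arclength {0..L} x has_vector_derivative 1 / p s $ 3) (at s within {0..L})"
proof -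
  let ?f = "\<lambda>s. sqrt (1 + (curvature {0..L} x s)\<^sup>2)"
  \<comment> \<open>The interval \<open>{0..b}\<close> must contain all points of
    \<open>{0..L}\<close> near \<open>s\<close> but avoid a cusp at \<open>L\<close>: hence the
    midpoint, unless \<open>s = L\<close>, where \<open>nz\<close> excludes a cusp.\<close>
  define b where "b = (if s = L then L else (s + L) / 2)"
  have b: "b \<in> {0<..L}" "s \<in> {0..b}" and b': "b = L \<or> s < b"
    using s L_pos by (auto simp: b_def)
  have "p b $ 3 \<noteq> 0"
  proof (cases "s = L")
    case False
    with s have "b \<in> {0<..<L}" by (auto simp: b_def)
    from lambda3_pos[OF this] show ?thesis by simp
  qed (use nz in \<open>simp add: b_def\<close>)
  from arclength_density_integrable[OF b(1) this] have int: "?f integrable_on {0..b}" .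
  have "((\<lambda>y. 1 / p y $ 3) \<longlongrightarrow> 1 / p s $ 3) (at s within {0..L})"
    using continuous_momentum[OF s, of 3] nz
    by (intro tendsto_divide tendsto_const) (auto simp: continuous_within)
  moreover have "\<forall>\<^sub>F y in at s within {0..L}. 1 / p y $ 3 = ?f y"
    using eventually_not_cusp[OF s] by eventually_elim (simp add: arclength_density)
  ultimately have "(?f \<longlongrightarrow> 1 / p s $ 3) (at s within {0..L})"
    by (rule Lim_transform_eventually)
  then have "continuous (at s within {0..L}) ?f"
    by (simp add: continuous_within arclength_density[OF s nz])
  then have "continuous (at s within {0..b}) ?f"
    by (rule continuous_within_subset) (use b in auto)
  with integral_has_vector_derivative_continuous_at[OF int, of s "{}"] b(2)
  have "(sr_arclength {0..L} x has_vector_derivative ?f s) (at s within {0..b})"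
    by (simp add: sr_arclength_def[abs_def])
  also have "at s within {0..b} = at s within {0..L}"
  proof (cases "b = L")
    case False
    then show ?thesis
      using b b' by (intro at_within_nhd[of s "{..<b}"]) auto
  qed simp
  finally show ?thesis by (simp add: arclength_density[OF s nz])
qed

end

subsection \<open>The torsion bounds\<close>

text \<open>By Cauchy-Schwarz, \<open>W\<^sup>2 \<le> (\<lambda>\<^sub>1\<^sup>2 + \<lambda>\<^sub>2\<^sup>2) (\<lambda>\<^sub>4\<^sup>2 + \<lambda>\<^sub>5\<^sup>2)\<close>, which makes \<open>r = \<lambda>\<^sub>4\<^sup>2 + \<lambda>\<^sub>5\<^sup>2\<close> a point where
  \<open>r\<^sup>2 - (1 - c\<^sup>2) r - W\<^sup>2\<close> is nonnegative; the product of its roots is not positive, so \<open>r\<close> is at least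
  the larger one.\<close>

lemma larger_root_le:
  fixes r q W :: real
  assumes r: "r > 0" and W: "W\<^sup>2 \<le> (r - q) * r"
  shows "sqrt (q\<^sup>2 + 4 * W\<^sup>2) + q \<le> 2 * r"
proof -
  have "q\<^sup>2 + 4 * W\<^sup>2 \<le> (2 * r - q)\<^sup>2"
    using W by (simp add: power2_eq_square algebra_simps)
  \<comment> \<open>Taking the root of the completed square needs this sign; it follows from
    \<open>r \<ge> q\<close>, as the product \<open>(r - q) * r\<close> is at least
    \<open>W\<^sup>2\<close>.\<close>
  moreover have "2 * r - q \<ge> 0"
  proof -
    have "(r - q) * r \<ge> 0" using W zero_le_power2[of W] by linarith
    with r have "r - q \<ge> 0" by (simp add: zero_le_mult_iff)
    with r show ?thesis by linarith
  qed
  ultimately have "sqrt (q\<^sup>2 + 4 * W\<^sup>2) \<le> 2 * r - q"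
    by (simp add: real_le_lsqrt)
  then show ?thesis by simp
qed

lemma (in cuspless_arc) W_square_le:
  assumes s: "s \<in> {0..L}"
  defines "r \<equiv> (p s $ 4)\<^sup>2 + (p s $ 5)\<^sup>2"
  shows "(W_integral (p 0))\<^sup>2 \<le> (r - (1 - (c_integral (p 0))\<^sup>2)) * r"
proof -
  \<comment> \<open>Lagrange's identity: the second square is the defect in Cauchy-Schwarz.\<close>
  have "(W_integral (p s))\<^sup>2 + (p s $ 1 * p s $ 5 - p s $ 2 * p s $ 4)\<^sup>2
      = ((p s $ 1)\<^sup>2 + (p s $ 2)\<^sup>2) * r"
    by (simp add: W_integral_def r_def power2_eq_square algebra_simps)
  then have "(W_integral (p s))\<^sup>2 \<le> ((p s $ 1)\<^sup>2 + (p s $ 2)\<^sup>2) * r"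
    using zero_le_power2[of "p s $ 1 * p s $ 5 - p s $ 2 * p s $ 4"] by linarith
  \<comment> \<open>Both sides equal \<open>c\<^sup>2 - \<lambda>\<^sub>3\<^sup>2\<close>, since
    \<open>\<lambda>\<^sub>3\<^sup>2 = 1 - r\<close>.\<close>
  also have "(p s $ 1)\<^sup>2 + (p s $ 2)\<^sup>2 = r - (1 - (c_integral (p 0))\<^sup>2)"
    using c_const[OF s] hamiltonian_eq[OF s] by (simp add: r_def)
  finally show ?thesis using W_const[OF s] by simp
qed

theorem theorem7:
  fixes x :: "real \<Rightarrow> real^3" and p :: "real \<Rightarrow> real^6" and L :: real and smax :: ereal
    and \<kappa> \<tau> t :: "real \<Rightarrow> real" and W c :: real
  assumes stationary: "stationary_curve x L p smax"
  defines "\<kappa> \<equiv> curvature {0..L} x"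
    and "\<tau> \<equiv> torsion {0..L} {s. p s $ 3 = 0} x"
    and "t \<equiv> sr_arclength {0..L} x"
    and "W \<equiv> W_integral (p 0)"
    and "c \<equiv> c_integral (p 0)"
  shows
    "(\<forall>s\<in>{0..L}.
        p s $ 1 = p 0 $ 1 * cosh s - p 0 $ 5 * sinh s \<and>
        p s $ 5 = p 0 $ 5 * cosh s - p 0 $ 1 * sinh s \<and>
        p s $ 2 = p 0 $ 2 * cosh s + p 0 $ 4 * sinh s \<and>
        p s $ 4 = p 0 $ 4 * cosh s + p 0 $ 2 * sinh s \<and>
        p s $ 3 = sqrt (1 - (p s $ 4)\<^sup>2 - (p s $ 5)\<^sup>2)) \<and>
     (\<forall>s\<in>{0..L}. p s $ 3 \<noteq> 0 \<longrightarrow>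
        \<kappa> s = sqrt ((p s $ 4)\<^sup>2 + (p s $ 5)\<^sup>2) / p s $ 3 \<and>
        \<kappa> s = sqrt (1 - (p s $ 3)\<^sup>2) / p s $ 3) \<and>
     (\<forall>s\<in>{0..L}. p s $ 3 = 0 \<longrightarrow>
        (frenet_torsion {0..L} x \<longlongrightarrow> \<tau> s) (at s within {0..L})) \<and>
     (\<forall>s\<in>{0..L}. (p s $ 4)\<^sup>2 + (p s $ 5)\<^sup>2 \<noteq> 0 \<longrightarrow>
        \<tau> s = W / ((p s $ 4)\<^sup>2 + (p s $ 5)\<^sup>2)) \<and>
     (\<forall>s\<in>{0..L}. p s $ 3 \<noteq> 0 \<and> (p s $ 4)\<^sup>2 + (p s $ 5)\<^sup>2 \<noteq> 0 \<longrightarrow>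
        t differentiable (at s within {0..L}) \<and>
        \<tau> s * (\<kappa> s)\<^sup>2 = W * (deriv_within {0..L} t s)\<^sup>2) \<and>
     (\<forall>s\<in>{0..L}. (p s $ 4)\<^sup>2 + (p s $ 5)\<^sup>2 \<noteq> 0 \<longrightarrow>
        \<bar>W\<bar> \<le> \<bar>\<tau> s\<bar> \<and>
        (sqrt ((1 - c\<^sup>2)\<^sup>2 + 4 * W\<^sup>2) + 1 - c\<^sup>2 \<noteq> 0 \<longrightarrow>
           \<bar>\<tau> s\<bar> \<le> 2 * \<bar>W\<bar> / (sqrt ((1 - c\<^sup>2)\<^sup>2 + 4 * W\<^sup>2) + 1 - c\<^sup>2)))"
proof -
  obtain R where "cuspless_geodesic x R p smax" and L: "0 < L" "ereal L \<le> smax"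
    using stationary unfolding stationary_curve_def by blast
  then interpret cuspless_arc x R p L smax by unfold_locales
  have \<kappa>: "\<kappa> s = sqrt ((p s $ 4)\<^sup>2 + (p s $ 5)\<^sup>2) / p s $ 3"
    "\<kappa> s = sqrt (1 - (p s $ 3)\<^sup>2) / p s $ 3" if s: "s \<in> {0..L}" "p s $ 3 \<noteq> 0" for s
  proof -
    have "(p s $ 4)\<^sup>2 + (p s $ 5)\<^sup>2 = 1 - (p s $ 3)\<^sup>2"
      using hamiltonian_eq[OF s(1)] by simp
    with curvature_eq[OF s] show "\<kappa> s = sqrt ((p s $ 4)\<^sup>2 + (p s $ 5)\<^sup>2) / p s $ 3"
      "\<kappa> s = sqrt (1 - (p s $ 3)\<^sup>2) / p s $ 3" by (simp_all add: \<kappa>_def)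
  qed
  have \<tau>: "\<tau> s = W / ((p s $ 4)\<^sup>2 + (p s $ 5)\<^sup>2)" if "s \<in> {0..L}" for s
    using torsion_eq[OF that] by (simp add: \<tau>_def W_def)
  have lim: "(frenet_torsion {0..L} x \<longlongrightarrow> \<tau> s) (at s within {0..L})"
    if "s \<in> {0..L}" "p s $ 3 = 0" for s
    using frenet_torsion_tendsto_cusp[OF that] \<tau>[OF that(1)] by (simp add: W_def)
  have arclength: "t differentiable (at s within {0..L}) \<and>
      \<tau> s * (\<kappa> s)\<^sup>2 = W * (deriv_within {0..L} t s)\<^sup>2"
    if s: "s \<in> {0..L}" "p s $ 3 \<noteq> 0" and r: "(p s $ 4)\<^sup>2 + (p s $ 5)\<^sup>2 \<noteq> 0" for s
  proof
    have t: "(t has_vector_derivative 1 / p s $ 3) (at s within {0..L})"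
      unfolding t_def by (rule sr_arclength_has_derivative[OF s])
    then show "t differentiable (at s within {0..L})"
      by (rule differentiableI_vector)
    show "\<tau> s * (\<kappa> s)\<^sup>2 = W * (deriv_within {0..L} t s)\<^sup>2"
      using r s by (simp add: deriv_within_eqI[OF L_pos s(1) t] \<tau> \<kappa>(1)[OF s] power_divide)
  qed
  have bounds: "\<bar>W\<bar> \<le> \<bar>\<tau> s\<bar> \<and>
      (sqrt ((1 - c\<^sup>2)\<^sup>2 + 4 * W\<^sup>2) + 1 - c\<^sup>2 \<noteq> 0 \<longrightarrow>
        \<bar>\<tau> s\<bar> \<le> 2 * \<bar>W\<bar> / (sqrt ((1 - c\<^sup>2)\<^sup>2 + 4 * W\<^sup>2) + 1 - c\<^sup>2))"
    if s: "s \<in> {0..L}" and nz: "(p s $ 4)\<^sup>2 + (p s $ 5)\<^sup>2 \<noteq> 0" for s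
  proof -
    define r where "r = (p s $ 4)\<^sup>2 + (p s $ 5)\<^sup>2"
    \<comment> \<open>Twice the larger root of the quadratic in \<open>r\<close>.\<close>
    define D where "D = sqrt ((1 - c\<^sup>2)\<^sup>2 + 4 * W\<^sup>2) + (1 - c\<^sup>2)"
    have r: "r > 0" using nz by (simp add: r_def less_le)
    have abs_\<tau>: "\<bar>\<tau> s\<bar> = \<bar>W\<bar> / r" using r \<tau>[OF s] by (simp add: r_def abs_divide)
    have "r \<le> 1"
      using hamiltonian_eq[OF s] zero_le_power2[of "p s $ 3"] unfolding r_def by linarith
    then have lower: "\<bar>W\<bar> \<le> \<bar>\<tau> s\<bar>"
      using r by (simp add: abs_\<tau> le_divide_eq mult_left_le)
    have D_le: "D \<le> 2 * r"
      using larger_root_le[OF r] W_square_le[OF s] by (simp add: D_def r_def W_def c_def)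
    \<comment> \<open>The left side is the absolute value of \<open>1 - c\<^sup>2\<close>, so
      \<open>D\<close> is nonnegative; it vanishes only if \<open>W = 0\<close> and
      \<open>c\<^sup>2 \<ge> 1\<close>.\<close>
    have "sqrt ((1 - c\<^sup>2)\<^sup>2) \<le> sqrt ((1 - c\<^sup>2)\<^sup>2 + 4 * W\<^sup>2)"
      by (rule real_sqrt_le_mono) simp
    then have D_nonneg: "D \<ge> 0" by (simp add: D_def)
    have "\<bar>\<tau> s\<bar> \<le> 2 * \<bar>W\<bar> / D" if "D \<noteq> 0"
    proof -
      have "2 * \<bar>W\<bar> / (2 * r) \<le> 2 * \<bar>W\<bar> / D"
        using that D_nonneg D_le r by (intro divide_left_mono) auto
      then show ?thesis by (simp add: abs_\<tau>)
    qed
    with lower show ?thesis by (simp add: D_def add_diff_eq)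
  qed
  show ?thesis
    by (intro conjI ballI impI)
       (rule momentum_explicit lambda3_eq \<kappa> \<tau> lim arclength[THEN conjunct1]
         arclength[THEN conjunct2] bounds[THEN conjunct1] bounds[THEN conjunct2, rule_format];
        (assumption | erule conjunct1 | erule conjunct2))+
qed

end
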